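(* Let $B$ be a finite Blaschke product defined in the unit disk. Then $R(B)$ contains a disk of radius $1/2$; that is, there exist a point $w_0\in\mathbb{C}$ and an injective holomorphic function $h:\{w:|w-w_0|<1/2\}\to\mathbb{D}$ such that $B(h(w))=w$ for all $w$ with $|w-w_0|<1/2$.
   Context: $\mathbb{D}=\{z\in\mathbb{C}:|z|<1\}$. A finite Blaschke product is a function of the form $B(z)=\prod_{j=1}^n\frac{z-z_j}{1-\overline{z_j}z}$ with $|z_j|<1$, $n\ge 1$. $R(B)$ is the Riemann surface given by the (ramified) covering $B:\mathbb{D}\to\mathbb{D}$. A Riemann surface $f_2:D_2\to G_2$ contains a Riemann surface $f_1:D_1\to G_1$ if there is an injective holomorphic function $h:D_1\to D_2$ such that $f_1=f_2\circ h$; a planar domain $D$ is identified with the Riemann surface $\mathrm{id}_D:D\to D$. *)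

theory Defs
  imports "HOL-Complex_Analysis.Complex_Analysis"
begin

text \<open>
  The zeros \<open>a j\<close> need not be distinct (multiplicities are repetitions), and only the values of
  \<open>B\<close> on the open unit disk are constrained.
\<close>

definition finite_blaschke_product :: "(complex \<Rightarrow> complex) \<Rightarrow> bool" where
  "finite_blaschke_product B \<longleftrightarrow>
     (\<exists>(n::nat) (a :: nat \<Rightarrow> complex). n \<ge> 1 \<and> (\<forall>j\<in>{1..n}. norm (a j) < 1) \<and>
        (\<forall>z\<in>ball 0 1. B z = (\<Prod>j=1..n. (z - a j) / (1 - cnj (a j) * z))))"

text \<open>
  A Riemann surface spread over the plane \<open>f : D \<rightarrow> G\<close> whose underlying surface \<open>D\<close> is a plane
  domain is represented by the pair \<open>(D, f)\<close>. The target \<open>G\<close> is not recorded: it plays no role in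
  the containment relation, which only compares values of the projections.
\<close>

type_synonym spread_surface = "complex set \<times> (complex \<Rightarrow> complex)"

definition surface_of :: "(complex \<Rightarrow> complex) \<Rightarrow> spread_surface" where
  "surface_of B = (ball 0 1, B)"

definition surface_of_domain :: "complex set \<Rightarrow> spread_surface" where
  "surface_of_domain D = (D, (\<lambda>w. w))"

definition surface_contains :: "spread_surface \<Rightarrow> spread_surface \<Rightarrow> bool" where
  "surface_contains S\<^sub>2 S\<^sub>1 \<longleftrightarrow>
     (case (S\<^sub>2, S\<^sub>1) of ((D\<^sub>2, f\<^sub>2), (D\<^sub>1, f\<^sub>1)) \<Rightarrow>
        \<exists>h. h holomorphic_on D\<^sub>1 \<and> inj_on h D\<^sub>1 \<and> h ` D\<^sub>1 \<subseteq> D\<^sub>2 \<and> (\<forall>w\<in>D\<^sub>1. f\<^sub>1 w = f\<^sub>2 (h w)))"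

end

theory Submission
  imports Defs
begin

text \<open>
  Let \<open>n\<close> be the degree of the Blaschke product \<open>B\<close>. One of the two disjoint disks \<open>ball (1/2) (1/2)\<close> and
  \<open>ball (-1/2) (1/2)\<close>, both contained in the unit disk, carries an inverse branch of \<open>B\<close>. The reason is
  a count of critical points, always with multiplicity.
  
  Let \<open>V\<close> be a component of the preimage of one of these disks. It is simply connected by the maximum
  principle (\<open>component_of_disc_preimage\<close>), and \<open>B\<close> maps \<open>V\<close> properly to the disk, with some degree
  \<open>d \<ge> 1\<close> (\<open>compact_preimage_component\<close>). By the Riemann-Hurwitz relation, \<open>V\<close> contains \<open>d - 1\<close> critical
  points of \<open>B\<close> (\<open>proper_map_to_disc_counts\<close>). If \<open>d = 1\<close>, then \<open>B\<close> maps \<open>V\<close> bijectively to the disk and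
  the inverse of this restriction is the desired branch (\<open>inverse_on_disc_of_degree_one\<close>). If no
  component of either preimage had degree \<open>1\<close>, then each would contain \<open>d - 1 \<ge> d / 2\<close> critical points.
  Since the degrees of the components over one disk add up to \<open>n\<close>, there would be at least
  \<open>n / 2 + n / 2 = n\<close> critical points in the unit disk. But \<open>B\<close> has only \<open>n - 1\<close> of them.
  
  Both uses of the Riemann-Hurwitz relation reduce to Blaschke products: a Riemann map turns the
  restriction of \<open>B\<close> to \<open>V\<close> into a proper self-map of the unit disk, which is a Blaschke product up to a
  unimodular constant (\<open>proper_self_map_eq_blaschke\<close>). For a nonconstant Blaschke product \<open>G\<close> the
  quotient \<open>z G'(z) / G(z)\<close> is positive on the unit circle, so \<open>z G'\<close> and \<open>G\<close> have the same number of
  zeros in the disk by the theorem of Rouche (\<open>critical_count_unimodular\<close>).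
\<close>

section \<open>Counting zeros with multiplicity\<close>

text \<open>
  The number of zeros of \<open>f\<close> in \<open>S\<close>, counted with multiplicity. It is integer-valued because \<open>zorder\<close>
  is. It is meaningful only when \<open>f\<close> has finitely many zeros in \<open>S\<close>: the sum over an infinite set is
  \<open>0\<close> by convention.
\<close>

definition zero_count :: "(complex \<Rightarrow> complex) \<Rightarrow> complex set \<Rightarrow> int" where
  "zero_count f S = (\<Sum>z\<in>{z\<in>S. f z = 0}. zorder f z)"

lemma zero_count_cong:
  assumes "open S" and "\<And>z. z \<in> S \<Longrightarrow> f z = g z"
  shows "zero_count f S = zero_count g S"
proof -
  have "zorder f z = zorder g z" if "z \<in> S" for z
  proof (rule zorder_cong)
    have "\<forall>\<^sub>F w in at z. w \<in> S"
      using assms(1) that by (simp add: eventually_at_in_open')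
    then show "\<forall>\<^sub>F w in at z. f w = g w"
      by eventually_elim (use assms(2) in auto)
  qed simp
  then show ?thesis
    unfolding zero_count_def using assms(2) by (intro sum.cong) auto
qed

lemma zero_count_cmult:
  assumes "c \<noteq> 0"
  shows "zero_count (\<lambda>z. c * f z) S = zero_count f S"
  using assms by (simp add: zero_count_def zorder_cmult)

lemma eventually_nonzero:
  assumes "f holomorphic_on S" "open S" "connected S" "z \<in> S" "\<exists>w\<in>S. f w \<noteq> 0"
  shows "\<forall>\<^sub>F w in at z. f w \<noteq> 0"
proof -
  from assms(5) obtain w where "w \<in> S" "f w \<noteq> 0" by blast
  then have "\<forall>\<^sub>F w in at z. f w \<noteq> 0 \<and> w \<in> S"
    using assms(1-4) by (intro non_zero_neighbour_alt[where \<beta> = w])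
  then show ?thesis by eventually_elim auto
qed

lemma zorder_pos_at_zero:
  assumes "f holomorphic_on S" "open S" "connected S" "z \<in> S" "\<exists>w\<in>S. f w \<noteq> 0" "f z = 0"
  shows "0 < zorder f z"
proof -
  have "\<exists>\<^sub>F w in at z. f w \<noteq> 0"
    using eventually_nonzero[OF assms(1-5)] by (simp add: eventually_frequently)
  then show ?thesis
    using assms zorder_pos_iff by blast
qed

lemma finite_zeros_compact:
  assumes "f holomorphic_on S" "open S" "connected S" "compact K" "K \<subseteq> S" "\<exists>z\<in>S. f z \<noteq> 0"
  shows "finite {z\<in>K. f z = 0}"
proof (cases "f constant_on S")
  case True
  then have "{z\<in>K. f z = 0} = {}"
    using assms(5,6) unfolding constant_on_def by force
  then show ?thesis by (simp only: finite.emptyI)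
next
  case False
  then show ?thesis using holomorphic_compact_finite_zeros assms by blast
qed

lemma analytic_on_cball_extend:
  assumes "f analytic_on cball 0 1"
  obtains R where "R > 1" "f holomorphic_on ball (0::complex) R"
proof -
  obtain S where S: "open S" "cball 0 1 \<subseteq> S" "f holomorphic_on S"
    using assms by (auto simp: analytic_on_holomorphic)
  obtain e where e: "e > 0" "(\<Union>x\<in>cball 0 1. ball x e) \<subseteq> S"
    using compact_subset_open_imp_ball_epsilon_subset[OF compact_cball S(1,2)] by blast
  have "ball 0 (1 + e) \<subseteq> S"
  proof
    fix z :: complex assume z: "z \<in> ball 0 (1 + e)"
    show "z \<in> S"
    proof (cases "norm z \<le> 1")
      case True
      then show ?thesis using S(2) by auto
    next
      case False
      \<comment> \<open>The point of the closed disk nearest to \<open>z\<close> is its radial projection to the circle.\<close>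
      then have "dist (z / of_real (norm z)) z = norm z - 1"
      proof -
        have "z / of_real (norm z) - z = (of_real (1 / norm z - 1)) * z"
          by (simp add: field_simps)
        then have "dist (z / of_real (norm z)) z = \<bar>1 / norm z - 1\<bar> * norm z"
          by (simp only: dist_norm norm_mult norm_of_real)
        also have "\<dots> = norm z - 1"
          using False by (auto simp: abs_if field_simps)
        finally show ?thesis .
      qed
      then have "z \<in> ball (z / of_real (norm z)) e"
        using z by (auto simp: dist_norm)
      moreover have "z / of_real (norm z) \<in> cball 0 1"
        using False by (simp add: norm_divide)
      ultimately show ?thesis using e(2) by blast
    qed
  qed
  then show ?thesis
    using S(3) e(1) holomorphic_on_subset that[of "1 + e"] by auto
qed

section \<open>Functions analytic on the closed unit disk\<close>

lemma zero_count_Rouche: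
  assumes f: "f analytic_on cball 0 1" and g: "g analytic_on cball 0 1"
    and less: "\<And>z. norm z = 1 \<Longrightarrow> norm (g z) < norm (f z)"
  shows "zero_count (\<lambda>z. f z + g z) (ball 0 1) = zero_count f (ball 0 1)"
proof -
  obtain R1 where R1: "R1 > 1" "f holomorphic_on ball 0 R1"
    using analytic_on_cball_extend[OF f] .
  obtain R2 where R2: "R2 > 1" "g holomorphic_on ball 0 R2"
    using analytic_on_cball_extend[OF g] .
  define R where "R = min R1 R2"
  \<comment> \<open>The disk of radius \<open>r < R\<close> is relatively compact in the domain, so it contains only finitely many
    zeros of \<open>f\<close> and of \<open>f + g\<close>.\<close>
  define r where "r = (1 + R) / 2"
  have Rr: "1 < r" "r < R" using R1 R2 by (auto simp: R_def r_def)
  have hol: "f holomorphic_on ball 0 R" "g holomorphic_on ball 0 R"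
    using R1 R2 by (auto simp: R_def intro: holomorphic_on_subset)
  then have hol': "(\<lambda>z. f z + g z) holomorphic_on ball 0 R"
    by (intro holomorphic_intros)
  have nz: "f z \<noteq> 0" "f z + g z \<noteq> 0" if "norm z = 1" for z
    using less[OF that] by (auto simp: add_eq_0_iff)
  have 1: "(1::complex) \<in> ball 0 R" using Rr by auto
  have ex: "\<exists>z\<in>ball 0 R. f z \<noteq> 0" "\<exists>z\<in>ball 0 R. f z + g z \<noteq> 0"
    using nz[of 1] by (intro bexI[OF _ 1]; simp)+
  have fin: "finite {z\<in>ball 0 r. h z = 0}"
    if "h holomorphic_on ball 0 R" "\<exists>z\<in>ball 0 R. h z \<noteq> 0" for h :: "complex \<Rightarrow> complex"
  proof (rule finite_subset)
    show "{z\<in>ball 0 r. h z = 0} \<subseteq> {z\<in>cball 0 r. h z = 0}" by auto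
    show "finite {z\<in>cball 0 r. h z = 0}"
      using that Rr by (intro finite_zeros_compact[of h "ball 0 R"]) auto
  qed
  have count: "(\<Sum>p\<in>{p\<in>ball 0 r. h p = 0}. winding_number (circlepath 0 1) p * zorder h p)
      = of_int (zero_count h (ball 0 1))"
    if h: "h holomorphic_on ball 0 R" "\<exists>z\<in>ball 0 R. h z \<noteq> 0"
      and nz: "\<And>z. norm z = 1 \<Longrightarrow> h z \<noteq> 0" for h
  proof -
    have "(\<Sum>p\<in>{p\<in>ball 0 r. h p = 0}. winding_number (circlepath 0 1) p * zorder h p)
       = (\<Sum>p\<in>{p\<in>ball 0 1. h p = 0}. winding_number (circlepath 0 1) p * zorder h p)"
    proof (rule sum.mono_neutral_right)
      show "finite {p\<in>ball 0 r. h p = 0}" by (rule fin[OF h])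
      show "{p\<in>ball 0 1. h p = 0} \<subseteq> {p\<in>ball 0 r. h p = 0}" using Rr by auto
      show "\<forall>p\<in>{p\<in>ball 0 r. h p = 0} - {p\<in>ball 0 1. h p = 0}.
          winding_number (circlepath 0 1) p * zorder h p = 0"
      proof
        fix p assume p: "p \<in> {p\<in>ball 0 r. h p = 0} - {p\<in>ball 0 1. h p = 0}"
        then have "norm p > 1" using nz[of p] by (cases "norm p = 1") auto
        then have "winding_number (circlepath 0 1) p = 0"
          by (intro winding_number_zero_outside[of _ "cball 0 1"]) auto
        then show "winding_number (circlepath 0 1) p * zorder h p = 0" by simp
      qed
    qed
    also have "\<dots> = (\<Sum>p\<in>{p\<in>ball 0 1. h p = 0}. of_int (zorder h p))"
      by (intro sum.cong) (auto simp: winding_number_circlepath)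
    finally show ?thesis by (simp add: zero_count_def)
  qed
  have "(\<Sum>p\<in>{p\<in>ball 0 r. f p + g p = 0}.
           winding_number (circlepath 0 1) p * zorder (\<lambda>p. f p + g p) p)
      = (\<Sum>p\<in>{p\<in>ball 0 r. f p = 0}. winding_number (circlepath 0 1) p * zorder f p)"
  proof (rule Rouche_theorem)
    show "\<forall>z. z \<notin> ball 0 r \<longrightarrow> winding_number (circlepath 0 1) z = 0"
      using Rr by (intro allI impI winding_number_zero_outside[of _ "cball 0 1"]) auto
    show "finite {p\<in>ball 0 r. f p + g p = 0}" "finite {p\<in>ball 0 r. f p = 0}"
      using fin hol hol' ex by auto
    show "f holomorphic_on ball 0 r" "g holomorphic_on ball 0 r"
      using hol Rr by (auto intro: holomorphic_on_subset)
  qed (use Rr less in auto)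
  then show ?thesis
    using count[of f] count[of "\<lambda>z. f z + g z"] hol hol' ex nz
    by (simp del: of_int_sum add: of_int_eq_iff)
qed

lemma analytic_on_cball_zeros:
  assumes f: "f analytic_on cball 0 1" and nz: "\<And>z. norm z = 1 \<Longrightarrow> f z \<noteq> 0"
  shows "finite {z\<in>ball 0 1. f z = 0}"
    and "\<And>z. norm z < 1 \<Longrightarrow> \<forall>\<^sub>F w in at z. f w \<noteq> 0"
    and "\<And>z. norm z < 1 \<Longrightarrow> f z = 0 \<Longrightarrow> 0 < zorder f z"
proof -
  obtain R where R: "R > 1" "f holomorphic_on ball 0 R"
    using analytic_on_cball_extend[OF f] .
  have "(1::complex) \<in> ball 0 R" using R by auto
  then have ex: "\<exists>z\<in>ball 0 R. f z \<noteq> 0" using nz[of 1] by (metis norm_one)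
  have "finite {z\<in>cball 0 1. f z = 0}"
    using R ex by (intro finite_zeros_compact[of f "ball 0 R"]) auto
  then show "finite {z\<in>ball 0 1. f z = 0}"
    by (rule finite_subset[rotated]) auto
  show "\<forall>\<^sub>F w in at z. f w \<noteq> 0" if "norm z < 1" for z
    using that R by (intro eventually_nonzero[OF R(2) _ _ _ ex]) auto
  show "0 < zorder f z" if "norm z < 1" "f z = 0" for z
    using that R by (intro zorder_pos_at_zero[OF R(2) _ _ _ ex]) auto
qed

lemma zero_count_times_ident:
  assumes f: "f analytic_on cball 0 1" and nz: "\<And>z. norm z = 1 \<Longrightarrow> f z \<noteq> 0"
  shows "zero_count (\<lambda>z. z * f z) (ball 0 1) = zero_count f (ball 0 1) + 1"
proof -
  let ?Z = "{z\<in>ball 0 1. f z = 0}"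
  note fin = analytic_on_cball_zeros(1)[OF f nz]
  have an: "f analytic_on {z}" if "z \<in> ball 0 1" for z
    using f that by (rule_tac analytic_on_subset) auto
  have ord: "zorder (\<lambda>z. z * f z) z = (if z = 0 then 1 else 0) + zorder f z" if "z \<in> ball 0 1" for z
  proof -
    have ev: "\<forall>\<^sub>F w in at z. f w \<noteq> 0" "\<forall>\<^sub>F w in at z. w \<noteq> 0"
      using analytic_on_cball_zeros(2)[OF f nz, of z] that
        eventually_nonzero[OF holomorphic_on_ident open_UNIV connected_UNIV UNIV_I] by auto
    have "zorder (\<lambda>z. z * f z) z = zorder (\<lambda>z. z) z + zorder f z"
    proof (rule zorder_times_analytic)
      show "f analytic_on {z}"
        using that by (rule an)
      show "\<forall>\<^sub>F z in at z. z * f z \<noteq> 0"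
        using ev by eventually_elim auto
    qed (auto intro: analytic_intros)
    moreover have "zorder (\<lambda>z::complex. z) 0 = 1"
      by (rule zorder_eqI[where S = UNIV and g = "\<lambda>_. 1"]) auto
    moreover have "zorder (\<lambda>z::complex. z) z = 0" if "z \<noteq> 0"
      using that by (intro zorder_eq_0I) auto
    ultimately show ?thesis by auto
  qed
  have "zero_count (\<lambda>z. z * f z) (ball 0 1) = (\<Sum>z\<in>insert 0 ?Z. zorder (\<lambda>z. z * f z) z)"
    unfolding zero_count_def by (rule sum.cong) auto
  also have "\<dots> = (\<Sum>z\<in>insert 0 ?Z. (if z = 0 then 1 else 0) + zorder f z)"
    by (rule sum.cong[OF refl], rule ord) auto
  also have "\<dots> = 1 + (\<Sum>z\<in>insert 0 ?Z. zorder f z)"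
    using fin by (simp add: sum.distrib)
  also have "(\<Sum>z\<in>insert 0 ?Z. zorder f z) = (\<Sum>z\<in>?Z. zorder f z)"
  proof (cases "0 \<in> ?Z")
    case False
    then have "zorder f 0 = 0"
      using an[of 0] by (intro zorder_eq_0I) auto
    then show ?thesis using fin False by (simp add: sum.insert_if)
  qed (simp add: insert_absorb)
  finally show ?thesis by (simp add: zero_count_def)
qed

text \<open>
  A function that is unimodular on the unit circle takes every value of the open disk equally often:
  the constant \<open>w\<close> is dominated by \<open>G\<close> on the circle.
\<close>

lemma zero_count_unimodular:
  assumes G: "G analytic_on cball 0 1"
    and unit: "\<And>z. norm z = 1 \<Longrightarrow> norm (G z) = 1" and w: "norm w < 1"
  shows "zero_count (\<lambda>z. G z - w) (ball 0 1) = zero_count G (ball 0 1)"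
  using zero_count_Rouche[OF G, of "\<lambda>_. - w"] unit w by simp

text \<open>
  The hypothesis on the logarithmic derivative says that the argument of \<open>G\<close> increases along the unit
  circle. The positive number \<open>z G'(z) / G(z)\<close> there makes \<open>z G'\<close> a positive multiple of \<open>G\<close>, so that
  both functions have equally many zeros in the disk; the factor \<open>z\<close> accounts for one of them.
\<close>

lemma critical_count_unimodular:
  assumes G: "G analytic_on cball 0 1"
    and unit: "\<And>z. norm z = 1 \<Longrightarrow> norm (G z) = 1"
    and pos: "\<And>z. norm z = 1 \<Longrightarrow> \<exists>t>0. z * deriv G z = of_real t * G z"
  shows "zero_count (deriv G) (ball 0 1) + 1 = zero_count G (ball 0 1)"
proof -
  define t where "t = (\<lambda>z. norm (deriv G z))"
  have dG: "deriv G analytic_on cball 0 1"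
    using G by (rule analytic_deriv)
  have t: "t z > 0" "z * deriv G z = of_real (t z) * G z" if "norm z = 1" for z
  proof -
    obtain s where s: "s > 0" "z * deriv G z = of_real s * G z"
      using pos[OF \<open>norm z = 1\<close>] by blast
    then have "norm (z * deriv G z) = norm (of_real s * G z)" by simp
    then have "t z = s" using s(1) that unit[OF that] by (simp add: norm_mult t_def)
    then show "t z > 0" "z * deriv G z = of_real (t z) * G z" using s by auto
  qed
  have "continuous_on (sphere 0 1) (deriv G)"
    using dG by (meson analytic_imp_holomorphic continuous_on_subset holomorphic_on_imp_continuous_on sphere_cball)
  then have "bounded (deriv G ` sphere 0 1)"
    by (intro compact_imp_bounded compact_continuous_image) auto
  then obtain M where M: "M > 0" "\<And>z. norm z = 1 \<Longrightarrow> t z \<le> M"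
    unfolding bounded_pos t_def by auto
  \<comment> \<open>Since \<open>0 < t z \<le> M\<close>, the difference between \<open>z G'(z) = t z * G z\<close> and \<open>M * G z\<close> has modulus
    \<open>M - t z < M\<close> on the circle, as required by the theorem of Rouche.\<close>
  have "zero_count (\<lambda>z. of_real M * G z + (z * deriv G z - of_real M * G z)) (ball 0 1)
      = zero_count (\<lambda>z. of_real M * G z) (ball 0 1)"
  proof (rule zero_count_Rouche)
    show "(\<lambda>z. of_real M * G z) analytic_on cball 0 1"
      "(\<lambda>z. z * deriv G z - of_real M * G z) analytic_on cball 0 1"
      using G dG by (auto intro!: analytic_intros)
    fix z :: complex assume z: "norm z = 1"
    have "z * deriv G z - of_real M * G z = of_real (t z - M) * G z"
      using t(2)[OF z] by (simp add: algebra_simps)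
    then have "norm (z * deriv G z - of_real M * G z) = \<bar>t z - M\<bar>"
      using unit[OF z] by (simp only: norm_mult norm_of_real mult_1_right)
    also have "\<dots> < M" using t(1)[OF z] M(2)[OF z] by auto
    finally show "norm (z * deriv G z - of_real M * G z) < norm (of_real M * G z)"
      using unit[OF z] M(1) by (simp add: norm_mult)
  qed
  then have "zero_count (\<lambda>z. z * deriv G z) (ball 0 1) = zero_count G (ball 0 1)"
    using M(1) by (simp add: zero_count_cmult)
  moreover have "zero_count (\<lambda>z. z * deriv G z) (ball 0 1) = zero_count (deriv G) (ball 0 1) + 1"
  proof (rule zero_count_times_ident[OF dG])
    fix z :: complex assume "norm z = 1"
    then show "deriv G z \<noteq> 0" using t(1)[of z] by (auto simp: t_def)
  qed
  ultimately show ?thesis by simp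
qed

section \<open>Blaschke products\<close>

text \<open>
  The automorphism of the unit disk that vanishes at \<open>a\<close>, for \<open>\<bar>a\<bar> < 1\<close>.
\<close>

definition blaschke_factor :: "complex \<Rightarrow> complex \<Rightarrow> complex" where
  "blaschke_factor a z = (z - a) / (1 - cnj a * z)"

lemma blaschke_denom_nonzero:
  assumes "norm a < 1" "norm z \<le> 1"
  shows "1 - cnj a * z \<noteq> 0"
proof
  assume "1 - cnj a * z = 0"
  then have "norm (cnj a * z) = 1" by (metis norm_one right_minus_eq)
  moreover have "norm (cnj a * z) < 1"
    using mult_left_le[of "norm z" "norm a"] assms by (simp add: norm_mult)
  ultimately show False by simp
qed

lemma blaschke_factor_analytic:
  assumes "norm a < 1"
  shows "blaschke_factor a analytic_on cball 0 1"
  unfolding blaschke_factor_def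
  by (intro analytic_intros) (use assms blaschke_denom_nonzero in auto)

lemma blaschke_factor_norm_less:
  assumes "norm a < 1" "norm z < 1"
  shows "norm (blaschke_factor a z) < 1"
  using Moebius_function_norm_lt_1[OF assms, of 0]
  by (simp add: Moebius_function_simple blaschke_factor_def)

lemma blaschke_factor_eq_0_iff:
  assumes "norm a < 1" "norm z \<le> 1"
  shows "blaschke_factor a z = 0 \<longleftrightarrow> z = a"
  using blaschke_denom_nonzero[OF assms] by (simp add: blaschke_factor_def)

lemma blaschke_factor_norm_eq:
  assumes "norm a < 1" "norm z = 1"
  shows "norm (blaschke_factor a z) = 1"
proof -
  have zz: "z * cnj z = 1" using assms(2) by (simp add: complex_norm_square[symmetric])
  then have "1 - cnj a * z = z * cnj (z - a)" by (simp add: algebra_simps)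
  then have "norm (1 - cnj a * z) = norm (z - a)"
    using assms(2) by (simp only: norm_mult complex_mod_cnj mult_1_left)
  moreover have "z \<noteq> a" using assms by auto
  ultimately show ?thesis by (simp add: blaschke_factor_def norm_divide)
qed

text \<open>
  On the circle \<open>1 - cnj a * z = z * cnj (z - a)\<close>, which gives \<open>t = (1 - \<bar>a\<bar>\<^sup>2) / \<bar>z - a\<bar>\<^sup>2\<close>.
\<close>

lemma blaschke_factor_log_derivative:
  assumes "norm a < 1" "norm z = 1"
  shows "\<exists>t>0. z * deriv (blaschke_factor a) z = of_real t * blaschke_factor a z"
proof -
  have nz: "1 - cnj a * z \<noteq> 0" using assms by (intro blaschke_denom_nonzero) auto
  have za: "z \<noteq> a" using assms by auto
  have zz: "z * cnj z = 1" using assms(2) by (simp add: complex_norm_square[symmetric])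
  define t where "t = (1 - (norm a)\<^sup>2) / (norm (z - a))\<^sup>2"
  have "(blaschke_factor a has_field_derivative (1 - cnj a * a) / (1 - cnj a * z)\<^sup>2) (at z)"
    unfolding blaschke_factor_def
    by (rule derivative_eq_intros refl nz)+ (use nz in \<open>simp add: field_simps power2_eq_square\<close>)
  then have d: "deriv (blaschke_factor a) z = (1 - cnj a * a) / (1 - cnj a * z)\<^sup>2"
    by (rule DERIV_imp_deriv)
  have den: "1 - cnj a * z = z * cnj (z - a)"
    using zz by (simp add: algebra_simps)
  have "of_real t = (1 - cnj a * a) / ((z - a) * cnj (z - a))"
    unfolding t_def of_real_divide of_real_diff complex_norm_square by (simp add: mult.commute)
  moreover have "z * ((1 - cnj a * a) / (1 - cnj a * z)\<^sup>2)
      = (1 - cnj a * a) / ((z - a) * cnj (z - a)) * ((z - a) / (1 - cnj a * z))"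
    using za assms(2) unfolding den by (simp add: divide_simps power2_eq_square)
  ultimately have "z * deriv (blaschke_factor a) z = of_real t * blaschke_factor a z"
    unfolding d blaschke_factor_def by simp
  moreover have "t > 0"
    using assms za by (auto simp: t_def abs_square_less_1 intro!: divide_pos_pos)
  ultimately show ?thesis by blast
qed

lemma zorder_blaschke_factor:
  assumes "norm a < 1" "norm z < 1"
  shows "zorder (blaschke_factor a) z = (if z = a then 1 else 0)"
proof (cases "z = a")
  case True
  have "zorder (blaschke_factor a) a = 1"
  proof (rule zorder_eqI[where S = "ball 0 1" and g = "\<lambda>z. 1 / (1 - cnj a * z)"])
    show "(\<lambda>z. 1 / (1 - cnj a * z)) holomorphic_on ball 0 1"
      by (intro holomorphic_intros) (use assms blaschke_denom_nonzero in auto)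
    show "1 / (1 - cnj a * a) \<noteq> 0"
      using assms blaschke_denom_nonzero[of a a] by auto
  qed (use assms in \<open>auto simp: blaschke_factor_def\<close>)
  then show ?thesis using True by simp
next
  case False
  have "blaschke_factor a analytic_on {z}"
    using blaschke_factor_analytic[OF assms(1)] by (rule analytic_on_subset) (use assms in auto)
  then show ?thesis
    using False assms blaschke_factor_eq_0_iff[of a z] by (auto intro: zorder_eq_0I)
qed

text \<open>
  The Blaschke product with constant \<open>c\<close> and zeros \<open>a j\<close>, \<open>j \<in> J\<close>. Repeated zeros are expressed by an
  index family that is not injective; the empty product, a constant, is included.
\<close>

definition blaschke_prod :: "complex \<Rightarrow> 'i set \<Rightarrow> ('i \<Rightarrow> complex) \<Rightarrow> complex \<Rightarrow> complex" where
  "blaschke_prod c J a z = c * (\<Prod>j\<in>J. blaschke_factor (a j) z)"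

text \<open>
  Blaschke products, with finitely many zeros in the open unit disk and a unimodular constant.
\<close>

locale blaschke =
  fixes c :: complex and J :: "'i set" and a :: "'i \<Rightarrow> complex"
  assumes c: "norm c = 1" and fin: "finite J" and a: "\<And>j. j \<in> J \<Longrightarrow> norm (a j) < 1"
begin

lemma analytic: "blaschke_prod c J a analytic_on cball 0 1"
  unfolding blaschke_prod_def [abs_def]
  using blaschke_factor_analytic a by (intro analytic_intros) auto

lemma norm_eq:
  assumes "norm z = 1"
  shows "norm (blaschke_prod c J a z) = 1"
  using assms c a blaschke_factor_norm_eq
  by (simp add: blaschke_prod_def norm_mult prod_norm[symmetric])

lemma norm_le:
  assumes "norm z < 1"
  shows "norm (blaschke_prod c J a z) \<le> 1"
proof -
  have "(\<Prod>j\<in>J. norm (blaschke_factor (a j) z)) \<le> 1"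
    using blaschke_factor_norm_less[OF a assms] by (intro prod_le_1) (auto intro: less_imp_le)
  then show ?thesis using c by (simp add: blaschke_prod_def norm_mult prod_norm[symmetric])
qed

lemma zorder:
  assumes "norm z < 1"
  shows "zorder (blaschke_prod c J a) z = (\<Sum>j\<in>J. if z = a j then 1 else 0)"
proof -
  have c0: "c \<noteq> 0" using c by auto
  have "zorder (blaschke_prod c J a) z = zorder (\<lambda>z. \<Prod>j\<in>J. blaschke_factor (a j) z) z"
    unfolding blaschke_prod_def [abs_def] using c0 by (rule zorder_cmult)
  also have "\<dots> = (\<Sum>j\<in>J. zorder (blaschke_factor (a j)) z)"
  proof (rule zorder_prod_analytic)
    show "blaschke_factor (a j) analytic_on {z}" if "j \<in> J" for j
      using blaschke_factor_analytic[OF a[OF that]]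
      by (rule analytic_on_subset) (use assms in auto)
    have "\<forall>\<^sub>F w in at z. w \<in> ball 0 1 - a ` J - {z}"
    proof -
      have "open (ball 0 1 - (a ` J - {z}))" using fin by (intro open_Diff finite_imp_closed) auto
      then have "\<forall>\<^sub>F w in at z. w \<in> ball 0 1 - (a ` J - {z}) - {z}"
        using assms by (intro eventually_at_in_open) auto
      then show ?thesis by eventually_elim auto
    qed
    then show "\<forall>\<^sub>F w in at z. (\<Prod>j\<in>J. blaschke_factor (a j) w) \<noteq> 0"
    proof eventually_elim
      case (elim w)
      then show ?case using fin a blaschke_factor_eq_0_iff by (force simp: prod_zero_iff)
    qed
  qed
  also have "\<dots> = (\<Sum>j\<in>J. if z = a j then 1 else 0)"
    by (intro sum.cong zorder_blaschke_factor assms a) auto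
  finally show ?thesis .
qed

lemma eq_0_iff:
  assumes "norm z \<le> 1"
  shows "blaschke_prod c J a z = 0 \<longleftrightarrow> z \<in> a ` J"
  using assms c a fin blaschke_factor_eq_0_iff by (auto simp: blaschke_prod_def prod_zero_iff)

lemma log_derivative:
  assumes "norm z = 1" "J \<noteq> {}"
  shows "\<exists>t>0. z * deriv (blaschke_prod c J a) z = of_real t * blaschke_prod c J a z"
proof -
  have an: "blaschke_factor (a j) analytic_on {z}" if "j \<in> J" for j
    using blaschke_factor_analytic[OF a[OF that]]
    by (rule analytic_on_subset) (use assms in auto)
  have "\<exists>t. (K \<noteq> {} \<longrightarrow> t > 0) \<and> t \<ge> 0 \<and>
      z * deriv (\<lambda>z. \<Prod>j\<in>K. blaschke_factor (a j) z) z = of_real t * (\<Prod>j\<in>K. blaschke_factor (a j) z)"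
    if "K \<subseteq> J" for K
    using finite_subset[OF that fin] that
  proof (induction K rule: finite_induct)
    case empty
    then show ?case by (auto intro!: exI[of _ 0])
  next
    case (insert k K)
    let ?P = "\<lambda>z. \<Prod>j\<in>K. blaschke_factor (a j) z"
    let ?f = "blaschke_factor (a k)"
    obtain t where t: "t \<ge> 0" "z * deriv ?P z = of_real t * ?P z"
      using insert by auto
    obtain s where s: "s > 0" "z * deriv ?f z = of_real s * ?f z"
      using blaschke_factor_log_derivative[of "a k" z] a insert.prems assms by auto
    have anP: "?P analytic_on {z}" "?f analytic_on {z}"
      using an insert.prems by (auto intro!: analytic_intros)
    then have "deriv (\<lambda>z. ?f z * ?P z) z = ?f z * deriv ?P z + deriv ?f z * ?P z"
      by (intro deriv_mult analytic_on_imp_differentiable_at[of _ "{z}"]) auto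
    then have "z * deriv (\<lambda>z. ?f z * ?P z) z = ?f z * (z * deriv ?P z) + (z * deriv ?f z) * ?P z"
      by (simp add: algebra_simps)
    also have "\<dots> = of_real (s + t) * (?f z * ?P z)"
      unfolding t s by (simp add: algebra_simps)
    finally show ?case
      using insert.hyps s(1) t(1) by (intro exI[of _ "s + t"]) simp
  qed
  then obtain t where t: "t > 0"
    "z * deriv (\<lambda>z. \<Prod>j\<in>J. blaschke_factor (a j) z) z = of_real t * (\<Prod>j\<in>J. blaschke_factor (a j) z)"
    using assms(2) by blast
  have "deriv (blaschke_prod c J a) z = c * deriv (\<lambda>z. \<Prod>j\<in>J. blaschke_factor (a j) z) z"
    unfolding blaschke_prod_def [abs_def]
    using an by (intro deriv_cmult analytic_on_imp_differentiable_at[of _ "{z}"] analytic_intros) auto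
  then show ?thesis
    using t by (intro exI[of _ t]) (simp add: blaschke_prod_def algebra_simps)
qed

lemma zero_count_shift:
  assumes "norm w < 1"
  shows "zero_count (\<lambda>z. blaschke_prod c J a z - w) (ball 0 1) = zero_count (blaschke_prod c J a) (ball 0 1)"
  using analytic norm_eq assms by (rule zero_count_unimodular)

lemma critical_count:
  assumes "J \<noteq> {}"
  shows "zero_count (deriv (blaschke_prod c J a)) (ball 0 1) + 1
    = zero_count (blaschke_prod c J a) (ball 0 1)"
  using analytic norm_eq log_derivative[OF _ assms] by (rule critical_count_unimodular)

end

section \<open>Proper holomorphic self-maps of the disk\<close>

lemma compact_sublevel_cball:
  fixes f :: "complex \<Rightarrow> complex"
  assumes "continuous_on (cball 0 1) f"
  shows "compact {z\<in>cball 0 1. norm (f z) \<le> \<rho>}"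
proof -
  have "closed {z\<in>cball 0 1. norm (f z) \<le> \<rho>}"
    using assms by (intro continuous_on_closed_Collect_le continuous_intros) auto
  moreover have "bounded {z\<in>cball 0 1. norm (f z) \<le> \<rho>}"
    by (rule bounded_subset[OF bounded_cball[of 0 1]]) auto
  ultimately show ?thesis by (simp add: compact_eq_bounded_closed)
qed

lemma compact_subset_ball_shrink:
  assumes "compact K" "K \<subseteq> ball 0 (1::real)"
  obtains s where "0 < s" "s < 1" "K \<subseteq> ball (0::complex) s"
proof (cases "K = {}")
  case True
  then show ?thesis using that[of "1/2"] by auto
next
  case False
  obtain x where x: "x \<in> K" "\<And>y. y \<in> K \<Longrightarrow> norm y \<le> norm x"
    using continuous_attains_sup[OF assms(1) False continuous_on_norm_id] by auto
  have "norm x < 1" using x(1) assms(2) by auto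
  moreover have "K \<subseteq> ball 0 ((norm x + 1) / 2)"
    using x(2) \<open>norm x < 1\<close> by force
  moreover have "0 < (norm x + 1) / 2" by (simp add: add_nonneg_pos)
  ultimately show ?thesis using that[of "(norm x + 1) / 2"] by auto
qed

text \<open>
  The maximum principle, applied to \<open>h\<close> and to \<open>1 / h\<close> on disks that exhaust the unit disk.
\<close>

lemma unimodular_of_boundary_values:
  assumes h: "h holomorphic_on ball 0 1" and nz: "\<And>z. z \<in> ball 0 1 \<Longrightarrow> h z \<noteq> 0"
    and bd: "\<And>\<rho>. 0 < \<rho> \<Longrightarrow> \<rho> < 1 \<Longrightarrow>
      \<exists>s<1. \<forall>z. s \<le> norm z \<longrightarrow> norm z < 1 \<longrightarrow> \<rho> \<le> norm (h z) \<and> norm (h z) \<le> 1 / \<rho>"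
    and z: "norm z < 1"
  shows "norm (h z) = 1"
proof -
  have *: "\<rho> \<le> norm (h z) \<and> norm (h z) \<le> 1 / \<rho>" if \<rho>: "0 < \<rho>" "\<rho> < 1" for \<rho>
  proof -
    obtain s where s: "s < 1"
      "\<And>z. s \<le> norm z \<Longrightarrow> norm z < 1 \<Longrightarrow> \<rho> \<le> norm (h z) \<and> norm (h z) \<le> 1 / \<rho>"
      using bd[OF \<rho>] by blast
    define r where "r = max s ((norm z + 1) / 2)"
    have r: "norm z < r" "r < 1" "s \<le> r" using s(1) z by (auto simp: r_def less_max_iff_disj)
    then have r0: "0 < r" using norm_ge_zero[of z] by linarith
    have bound: "norm (k z) \<le> 1 / \<rho>"
      if "k holomorphic_on ball 0 1" "\<And>z. norm z = r \<Longrightarrow> norm (k z) \<le> 1 / \<rho>" for k :: "complex \<Rightarrow> complex"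
    proof (rule maximum_modulus_frontier[where S = "ball 0 r" and f = k and \<xi> = z and B = "1 / \<rho>"])
      show "k holomorphic_on interior (ball 0 r)" "continuous_on (closure (ball 0 r)) k"
        using that(1) r r0 by (auto intro!: holomorphic_on_imp_continuous_on intro: holomorphic_on_subset)
      show "\<And>z. z \<in> frontier (ball 0 r) \<Longrightarrow> norm (k z) \<le> 1 / \<rho>"
        using that(2) r0 by (auto simp: frontier_ball)
    qed (use r in auto)
    have "norm (h z) \<le> 1 / \<rho>"
      by (rule bound[OF h]) (use s r in auto)
    moreover have "norm (1 / h z) \<le> 1 / \<rho>"
    proof (rule bound)
      show "(\<lambda>z. 1 / h z) holomorphic_on ball 0 1"
        using h nz by (intro holomorphic_intros) auto
      show "norm (1 / h z) \<le> 1 / \<rho>" if "norm z = r" for z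
        using s(2)[of z] that r \<rho> by (auto simp: norm_divide intro!: divide_left_mono mult_pos_pos)
    qed
    ultimately show ?thesis
      using \<rho> nz[of z] z by (auto simp: norm_divide field_simps)
  qed
  have "norm (h z) \<le> 1 + e" if "e > 0" for e
    using *[of "1 / (1 + e)"] that by auto
  then have "norm (h z) \<le> 1" by (rule field_le_epsilon)
  moreover have "1 \<le> norm (h z)"
    by (rule dense_le_bounded[of 0]) (use * in auto)
  ultimately show ?thesis by simp
qed

text \<open>
  Properness is expressed by compactness of the sets \<open>{\<bar>F\<bar> \<le> \<rho>}\<close>, \<open>\<rho> < 1\<close>; it means that \<open>\<bar>F\<bar>\<close> tends to \<open>1\<close>
  at the unit circle. The quotient of \<open>F\<close> by the Blaschke product with the same zeros then has no
  zeros and boundary modulus \<open>1\<close>, hence is constant.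
\<close>

lemma proper_self_map_eq_blaschke:
  assumes F: "F holomorphic_on ball 0 1"
    and lt: "\<And>z. norm z < 1 \<Longrightarrow> norm (F z) < 1"
    and proper: "\<And>\<rho>. \<rho> < 1 \<Longrightarrow> compact {z\<in>ball 0 1. norm (F z) \<le> \<rho>}"
  obtains c and J :: "(complex \<times> nat) set" where
    "blaschke c J fst" "J \<noteq> {}" "\<And>z. norm z < 1 \<Longrightarrow> F z = blaschke_prod c J fst z"
proof -
  have near: "\<exists>s. 0 < s \<and> s < 1 \<and> (\<forall>z. s \<le> norm z \<longrightarrow> norm z < 1 \<longrightarrow> \<rho> < norm (F z))" if \<rho>: "\<rho> < 1" for \<rho>
  proof -
    obtain s where "0 < s" "s < 1" "{z\<in>ball 0 1. norm (F z) \<le> \<rho>} \<subseteq> ball 0 s"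
      using compact_subset_ball_shrink[OF proper[OF \<rho>]] by (metis (no_types, lifting) mem_Collect_eq subsetI)
    then show ?thesis by (intro exI[of _ s]) force
  qed
  define Z where "Z = {z\<in>ball 0 1. F z = 0}"
  obtain s0 where s0: "0 < s0" "s0 < 1" "\<And>z. s0 \<le> norm z \<Longrightarrow> norm z < 1 \<Longrightarrow> 0 < norm (F z)"
    using near[of 0] by auto
  have ex: "\<exists>z\<in>ball 0 1. F z \<noteq> 0"
    using s0(3)[of "of_real s0"] s0(1,2) by (intro bexI[of _ "of_real s0"]) auto
  have "finite {z\<in>cball 0 s0. F z = 0}"
    using F ex s0 by (intro finite_zeros_compact[of F "ball 0 1"]) auto
  moreover have "Z \<subseteq> {z\<in>cball 0 s0. F z = 0}"
    using s0(3) by (force simp: Z_def)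
  ultimately have finZ: "finite Z" by (rule rev_finite_subset)
  have ana: "F analytic_on {z}" if "z \<in> ball 0 1" for z
    using F that by (meson analytic_at open_ball)
  have zpos: "0 < zorder F z" if "z \<in> Z" for z
    using that by (intro zorder_pos_at_zero[OF F _ _ _ ex]) (auto simp: Z_def)
  \<comment> \<open>Each zero is listed as often as its multiplicity demands.\<close>
  define J where "J = Sigma Z (\<lambda>z. {..<nat (zorder F z)})"
  interpret b: blaschke 1 J fst
    by standard (use finZ in \<open>auto simp: J_def Z_def\<close>)
  let ?b = "blaschke_prod 1 J fst"
  have imJ: "fst ` J = Z"
  proof
    show "fst ` J \<subseteq> Z" by (auto simp: J_def)
    show "Z \<subseteq> fst ` J"
    proof
      fix z assume "z \<in> Z"
      then have "(z, 0) \<in> J" using zpos by (simp add: J_def)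
      then show "z \<in> fst ` J" by force
    qed
  qed
  have b0: "?b z = 0 \<longleftrightarrow> F z = 0" if "z \<in> ball 0 1" for z
    using that b.eq_0_iff[of z] imJ by (auto simp: Z_def)
  have ord: "zorder ?b z = zorder F z" if z: "z \<in> ball 0 1" for z
  proof -
    have "zorder ?b z = (\<Sum>j\<in>J. if z = fst j then 1 else 0)"
      using z by (intro b.zorder) auto
    also have "\<dots> = (\<Sum>x\<in>Z. \<Sum>k<nat (zorder F x). if z = x then 1 else 0)"
      unfolding J_def using finZ by (subst sum.Sigma) (auto intro!: sum.cong)
    also have "\<dots> = (\<Sum>x\<in>Z. if z = x then int (nat (zorder F x)) else 0)"
      by (intro sum.cong) auto
    also have "\<dots> = (if z \<in> Z then int (nat (zorder F z)) else 0)"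
      using finZ by simp
    also have "\<dots> = zorder F z"
    proof (cases "z \<in> Z")
      case True
      then show ?thesis using zpos[OF True] by simp
    next
      case False
      then show ?thesis using zorder_eq_0I[OF ana[OF z]] z by (auto simp: Z_def)
    qed
    finally show ?thesis .
  qed
  have bhol: "?b holomorphic_on ball 0 1"
    by (rule analytic_imp_holomorphic, rule analytic_on_subset[OF b.analytic]) auto
  obtain h where h: "h holomorphic_on ball 0 1" "\<And>z. z \<in> ball 0 1 \<Longrightarrow> h z \<noteq> 0"
    "\<And>z. z \<in> ball 0 1 \<Longrightarrow> F z = h z * ?b z"
    using holomorphic_zorder_factorization[OF F open_ball connected_ball bhol b0 ord] by blast
  have h1: "norm (h z) = 1" if "norm z < 1" for z
  proof (rule unimodular_of_boundary_values[OF h(1,2) _ that])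
    fix \<rho> :: real assume \<rho>: "0 < \<rho>" "\<rho> < 1"
    obtain s1 where s1: "0 < s1" "s1 < 1" "\<And>z. s1 \<le> norm z \<Longrightarrow> norm z < 1 \<Longrightarrow> \<rho> < norm (F z)"
      using near[OF \<rho>(2)] by auto
    have cont: "continuous_on (cball 0 1) ?b"
      by (intro holomorphic_on_imp_continuous_on analytic_imp_holomorphic b.analytic)
    have "compact {z\<in>cball 0 1. norm (?b z) \<le> \<rho>}"
      using cont by (rule compact_sublevel_cball)
    moreover have "{z\<in>cball 0 1. norm (?b z) \<le> \<rho>} \<subseteq> ball 0 1"
    proof
      fix z assume z: "z \<in> {z\<in>cball 0 1. norm (?b z) \<le> \<rho>}"
      then have "norm z \<noteq> 1" using b.norm_eq[of z] \<rho>(2) by auto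
      then show "z \<in> ball 0 1" using z by auto
    qed
    ultimately obtain s2 where s2: "s2 < 1" "{z\<in>cball 0 1. norm (?b z) \<le> \<rho>} \<subseteq> ball 0 s2"
      using compact_subset_ball_shrink by metis
    have "\<rho> \<le> norm (h z) \<and> norm (h z) \<le> 1 / \<rho>" if z: "max s1 s2 \<le> norm z" "norm z < 1" for z
    proof -
      have b: "\<rho> < norm (?b z)" "norm (?b z) \<le> 1"
      proof -
        have "z \<notin> ball 0 s2" using z by auto
        then show "\<rho> < norm (?b z)" using s2(2) z by force
        show "norm (?b z) \<le> 1" using z by (intro b.norm_le)
      qed
      have Fz: "\<rho> < norm (F z)" "norm (F z) < 1" using s1(3) z lt by auto
      have eq: "norm (F z) = norm (h z) * norm (?b z)"
        using h(3)[of z] z by (simp add: norm_mult)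
      have "norm (F z) \<le> norm (h z)"
        unfolding eq using b(2) by (rule mult_left_le) simp
      moreover have "norm (h z) * \<rho> \<le> norm (h z) * norm (?b z)"
        using b(1) by (intro mult_left_mono) auto
      ultimately show ?thesis using Fz \<rho>(1) eq by (auto simp: field_simps)
    qed
    then show "\<exists>s<1. \<forall>z. s \<le> norm z \<longrightarrow> norm z < 1 \<longrightarrow> \<rho> \<le> norm (h z) \<and> norm (h z) \<le> 1 / \<rho>"
      using s1(2) s2(1) by (intro exI[of _ "max s1 s2"]) auto
  qed
  have "h constant_on ball 0 1"
    by (rule maximum_modulus_principle[OF h(1), of "ball 0 1" 0]) (auto simp: h1)
  then obtain c where c: "\<And>z. z \<in> ball 0 1 \<Longrightarrow> h z = c"
    by (auto simp: constant_on_def)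
  have "norm c = 1" using c[of 0] h1[of 0] by simp
  then have bl: "blaschke c J fst"
    using b.fin b.a by (auto simp: blaschke_def)
  have eq: "F z = blaschke_prod c J fst z" if "norm z < 1" for z
    using h(3)[of z] c[of z] that by (simp add: blaschke_prod_def)
  have "J \<noteq> {}"
  proof
    assume "J = {}"
    then have "F 0 = c" using eq[of 0] by (simp add: blaschke_prod_def)
    then show False using lt[of 0] \<open>norm c = 1\<close> by simp
  qed
  then show ?thesis using that bl eq by blast
qed

text \<open>
  A proper self-map of the disk of degree \<open>d\<close> takes each value \<open>d\<close> times and has \<open>d - 1\<close> critical points.
\<close>

lemma proper_self_map_counts:
  assumes F: "F holomorphic_on ball 0 1"
    and lt: "\<And>z. norm z < 1 \<Longrightarrow> norm (F z) < 1"
    and proper: "\<And>\<rho>. \<rho> < 1 \<Longrightarrow> compact {z\<in>ball 0 1. norm (F z) \<le> \<rho>}"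
  shows "norm w < 1 \<Longrightarrow> zero_count (\<lambda>z. F z - w) (ball 0 1) = zero_count F (ball 0 1)"
    and "zero_count (deriv F) (ball 0 1) + 1 = zero_count F (ball 0 1)"
proof -
  obtain c and J :: "(complex \<times> nat) set" where cJ: "blaschke c J fst" "J \<noteq> {}"
    and eq: "\<And>z. norm z < 1 \<Longrightarrow> F z = blaschke_prod c J fst z"
    using proper_self_map_eq_blaschke[OF assms] by blast
  interpret blaschke c J fst by fact
  have Feq: "zero_count F (ball 0 1) = zero_count (blaschke_prod c J fst) (ball 0 1)"
    by (intro zero_count_cong) (auto simp: eq)
  show "zero_count (\<lambda>z. F z - w) (ball 0 1) = zero_count F (ball 0 1)" if "norm w < 1"
    unfolding Feq zero_count_shift[OF that, symmetric]
    by (intro zero_count_cong) (auto simp: eq)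
  have "deriv F z = deriv (blaschke_prod c J fst) z" if "z \<in> ball 0 1" for z
  proof (rule deriv_cong_ev)
    have "\<forall>\<^sub>F w in nhds z. w \<in> ball 0 1"
      using that by (intro eventually_nhds_in_open) auto
    then show "\<forall>\<^sub>F w in nhds z. F w = blaschke_prod c J fst w"
      by eventually_elim (auto simp: eq)
  qed simp
  then have "zero_count (deriv F) (ball 0 1) = zero_count (deriv (blaschke_prod c J fst)) (ball 0 1)"
    by (intro zero_count_cong) auto
  then show "zero_count (deriv F) (ball 0 1) + 1 = zero_count F (ball 0 1)"
    using critical_count[OF cJ(2)] Feq by simp
qed

section \<open>Proper maps of simply connected domains onto a disk\<close>

lemma zero_count_mult_nonvanishing:
  assumes "f holomorphic_on S" "open S" "connected S" "\<exists>z\<in>S. f z \<noteq> 0"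
    and "g holomorphic_on S" "\<And>z. z \<in> S \<Longrightarrow> g z \<noteq> 0"
  shows "zero_count (\<lambda>z. f z * g z) S = zero_count f S"
proof -
  have "zorder (\<lambda>z. f z * g z) z = zorder f z" if z: "z \<in> S" for z
  proof -
    have an: "f analytic_on {z}" "g analytic_on {z}"
      using assms(1,2,5) z analytic_at by blast+
    have "\<forall>\<^sub>F w in at z. f w \<noteq> 0"
      by (rule eventually_nonzero[OF assms(1-3) z assms(4)])
    moreover have "\<forall>\<^sub>F w in at z. w \<in> S"
      using assms(2) z by (simp add: eventually_at_in_open')
    ultimately have "\<forall>\<^sub>F w in at z. f w * g w \<noteq> 0"
      by eventually_elim (simp add: assms(6))
    then have "zorder (\<lambda>z. f z * g z) z = zorder f z + zorder g z"
      by (rule zorder_times_analytic[OF an])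
    then show ?thesis using zorder_eq_0I[OF an(2)] assms(6) z by simp
  qed
  then show ?thesis
    unfolding zero_count_def using assms(6) by (intro sum.cong) auto
qed

lemma zorder_compose_injective:
  assumes f: "f holomorphic_on T" "open T" "connected T" "\<exists>w\<in>T. f w \<noteq> 0"
    and g: "g holomorphic_on S" "open S" "inj_on g S" "g ` S \<subseteq> T" and z: "z \<in> S"
  shows "zorder (\<lambda>z. f (g z)) z = zorder f (g z)"
proof -
  have gz: "g z \<in> T" using g z by auto
  have an: "f analytic_on {g z}" "g analytic_on {z}"
    using f g gz z analytic_at by blast+
  have "zorder (f \<circ> g) z = zorder f (g z) * zorder (\<lambda>x. g x - g z) z"
  proof (rule zorder_compose')
    show "\<forall>\<^sub>F w in at (g z). f w \<noteq> 0"
      by (rule eventually_nonzero[OF f(1-3) gz f(4)])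
    have "\<forall>\<^sub>F w in at z. w \<in> S - {z}"
      using g(2) z by (intro eventually_at_in_open) auto
    then show "\<forall>\<^sub>F w in at z. g w \<noteq> g z"
      by eventually_elim (use g(3) z in \<open>auto dest: inj_onD\<close>)
  qed (use an isolated_singularity_at_analytic not_essential_analytic in blast)+
  also have "zorder (\<lambda>x. g x - g z) z = 1"
  proof (rule zorder_zero_eqI[where S = S])
    show "(\<lambda>x. g x - g z) holomorphic_on S" using g(1) by (intro holomorphic_intros)
    have "deriv (\<lambda>x. g x - g z) z = deriv g z"
      using an(2) by (subst deriv_diff) (auto intro: analytic_on_imp_differentiable_at)
    then show "(deriv ^^ nat 1) (\<lambda>x. g x - g z) z \<noteq> 0"
      using holomorphic_injective_imp_regular[OF g(1,2,3) z] by simp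
  qed (use g z in auto)
  finally show ?thesis by (simp add: o_def)
qed

lemma zero_count_compose_biholomorphic:
  assumes f: "f holomorphic_on T" "open T" "connected T" "\<exists>w\<in>T. f w \<noteq> 0"
    and g: "g holomorphic_on S" "open S" "bij_betw g S T"
  shows "zero_count (\<lambda>z. f (g z)) S = zero_count f T"
proof -
  have inj: "inj_on g S" "g ` S = T" using g(3) by (auto simp: bij_betw_def)
  have "zero_count (\<lambda>z. f (g z)) S = (\<Sum>z\<in>{z\<in>S. f (g z) = 0}. zorder f (g z))"
    unfolding zero_count_def
    by (intro sum.cong refl zorder_compose_injective[OF f g(1,2) inj(1)]) (use inj in auto)
  also have "\<dots> = (\<Sum>w\<in>{w\<in>T. f w = 0}. zorder f w)"
  proof (rule sum.reindex_bij_betw)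
    show "bij_betw g {z\<in>S. f (g z) = 0} {w\<in>T. f w = 0}"
      using inj by (auto simp: bij_betw_def intro: inj_on_subset)
  qed
  finally show ?thesis by (simp add: zero_count_def)
qed

text \<open>
  The Riemann-Hurwitz relation for a proper map from a simply connected domain to a disk, obtained
  from the case of self-maps of the unit disk by means of a Riemann map.
\<close>

lemma proper_map_to_disc_counts:
  assumes V: "open V" "connected V" "simply_connected V" "V \<noteq> {}" "V \<noteq> UNIV"
    and f: "f holomorphic_on V" and r: "0 < r"
    and lt: "\<And>z. z \<in> V \<Longrightarrow> norm (f z - c) < r"
    and proper: "\<And>\<rho>. \<rho> < r \<Longrightarrow> compact {z\<in>V. norm (f z - c) \<le> \<rho>}"
  shows "\<And>w. norm (w - c) < r \<Longrightarrow> zero_count (\<lambda>z. f z - w) V = zero_count (\<lambda>z. f z - c) V"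
    and "zero_count (deriv f) V + 1 = zero_count (\<lambda>z. f z - c) V"
    and "\<not> f constant_on V"
proof -
  show nconst: "\<not> f constant_on V"
  proof
    assume "f constant_on V"
    then obtain k where k: "\<And>z. z \<in> V \<Longrightarrow> f z = k" by (auto simp: constant_on_def)
    obtain z where z: "z \<in> V" using V by auto
    have "{z\<in>V. norm (f z - c) \<le> norm (k - c)} = V" using k by auto
    then have "compact V" using proper[of "norm (k - c)"] lt[OF z] k[OF z] by simp
    then show False using V compact_open by blast
  qed
  have ex: "\<exists>z\<in>V. f z - w \<noteq> 0" for w
    using nconst by (auto simp: constant_on_def)
  have df: "deriv f holomorphic_on V" using f V(1) by (rule holomorphic_deriv)
  have exd: "\<exists>z\<in>V. deriv f z \<noteq> 0"
  proof (rule ccontr)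
    assume "\<not> ?thesis"
    then have "(f has_field_derivative 0) (at z)" if "z \<in> V" for z
      using that f V(1) holomorphic_derivI by fastforce
    then obtain k where "\<And>z. z \<in> V \<Longrightarrow> f z = k"
      using DERIV_zero_connected_constant[of V "{}" f] V f holomorphic_on_imp_continuous_on by auto
    then show False using nconst by (auto simp: constant_on_def)
  qed
  obtain \<phi> \<psi> where hol: "\<phi> holomorphic_on V" "\<psi> holomorphic_on ball 0 1"
    and \<phi>: "\<And>z. z \<in> V \<Longrightarrow> \<phi> z \<in> ball 0 1 \<and> \<psi> (\<phi> z) = z"
    and \<psi>: "\<And>z. z \<in> ball 0 1 \<Longrightarrow> \<psi> z \<in> V \<and> \<phi> (\<psi> z) = z"
  proof -
    have "\<exists>\<phi> \<psi>. \<phi> holomorphic_on V \<and> \<psi> holomorphic_on ball 0 1 \<and>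
        (\<forall>z\<in>V. \<phi> z \<in> ball 0 1 \<and> \<psi> (\<phi> z) = z) \<and> (\<forall>z\<in>ball 0 1. \<psi> z \<in> V \<and> \<phi> (\<psi> z) = z)"
      using simply_connected_eq_biholomorphic_to_disc[OF V(1)] V(3-5) by blast
    then show ?thesis using that by blast
  qed
  have bij: "bij_betw \<psi> (ball 0 1) V"
    by (rule bij_betwI[where g = \<phi>]) (use \<phi> \<psi> in auto)
  then have im: "\<psi> ` ball 0 1 \<subseteq> V" by (simp add: bij_betw_def)
  \<comment> \<open>After transport to the unit disk and normalization of the target, \<open>f\<close> is a proper self-map.\<close>
  define F where "F = (\<lambda>z. of_real (1 / r) * (f (\<psi> z) - c))"
  have normF: "norm (F z) = norm (f (\<psi> z) - c) / r" for z
    using r by (simp add: F_def norm_divide)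
  have f\<psi>: "(\<lambda>z. f (\<psi> z)) holomorphic_on ball 0 1"
    using holomorphic_on_compose_gen[OF hol(2) f im] by (simp add: o_def)
  have F: "F holomorphic_on ball 0 1"
    unfolding F_def by (intro holomorphic_intros f\<psi>)
  have Flt: "norm (F z) < 1" if "norm z < 1" for z
    using lt[of "\<psi> z"] \<psi>[of z] that r by (simp add: normF)
  have Fproper: "compact {z\<in>ball 0 1. norm (F z) \<le> \<rho>}" if "\<rho> < 1" for \<rho>
  proof -
    have "compact {z\<in>V. norm (f z - c) \<le> \<rho> * r}"
      using that r by (intro proper) auto
    then have "compact (\<phi> ` {z\<in>V. norm (f z - c) \<le> \<rho> * r})"
      using hol(1) by (intro compact_continuous_image holomorphic_on_imp_continuous_on)
        (auto intro: holomorphic_on_subset)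
    also have "\<phi> ` {z\<in>V. norm (f z - c) \<le> \<rho> * r} = {z\<in>ball 0 1. norm (F z) \<le> \<rho>}"
    proof (intro equalityI subsetI)
      fix z assume "z \<in> {z\<in>ball 0 1. norm (F z) \<le> \<rho>}"
      then show "z \<in> \<phi> ` {z\<in>V. norm (f z - c) \<le> \<rho> * r}"
        using \<psi>[of z] r by (intro image_eqI[of _ _ "\<psi> z"]) (auto simp: normF field_simps)
    qed (use \<phi> r in \<open>auto simp: normF field_simps\<close>)
    finally show ?thesis .
  qed
  note counts = proper_self_map_counts[OF F Flt Fproper]
  have shift: "zero_count (\<lambda>z. F z - of_real (1 / r) * (w - c)) (ball 0 1) = zero_count (\<lambda>z. f z - w) V" for w
  proof -
    have "(\<lambda>z. F z - of_real (1 / r) * (w - c)) = (\<lambda>z. of_real (1 / r) * (f (\<psi> z) - w))"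
      by (simp add: F_def fun_eq_iff diff_divide_distrib)
    then have "zero_count (\<lambda>z. F z - of_real (1 / r) * (w - c)) (ball 0 1)
        = zero_count (\<lambda>z. of_real (1 / r) * (f (\<psi> z) - w)) (ball 0 1)"
      by (simp only:)
    also have "\<dots> = zero_count (\<lambda>z. f (\<psi> z) - w) (ball 0 1)"
      using r by (intro zero_count_cmult) auto
    also have "\<dots> = zero_count (\<lambda>z. f z - w) V"
      using f by (intro zero_count_compose_biholomorphic[of "\<lambda>z. f z - w"] V hol bij ex)
        (auto intro!: holomorphic_intros)
    finally show ?thesis .
  qed
  have F0: "zero_count F (ball 0 1) = zero_count (\<lambda>z. f z - c) V"
    using shift[of c] by simp
  show "zero_count (\<lambda>z. f z - w) V = zero_count (\<lambda>z. f z - c) V" if "norm (w - c) < r" for w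
    using counts(1)[of "of_real (1 / r) * (w - c)"] that r shift[of w] F0
    by (simp add: norm_divide)
  have dF: "deriv F z = of_real (1 / r) * (deriv f (\<psi> z) * deriv \<psi> z)" if "z \<in> ball 0 1" for z
  proof (rule DERIV_imp_deriv)
    have "(\<psi> has_field_derivative deriv \<psi> z) (at z)"
      using hol(2) that by (intro holomorphic_derivI) auto
    moreover have "(f has_field_derivative deriv f (\<psi> z)) (at (\<psi> z))"
      using f V(1) \<psi>[OF that] by (intro holomorphic_derivI) auto
    ultimately have "((\<lambda>z. f (\<psi> z)) has_field_derivative deriv f (\<psi> z) * deriv \<psi> z) (at z)"
      by (rule DERIV_chain2[rotated])
    then show "(F has_field_derivative of_real (1 / r) * (deriv f (\<psi> z) * deriv \<psi> z)) (at z)"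
      unfolding F_def using r by (auto intro!: derivative_eq_intros)
  qed
  have "zero_count (deriv F) (ball 0 1)
      = zero_count (\<lambda>z. of_real (1 / r) * (deriv f (\<psi> z) * deriv \<psi> z)) (ball 0 1)"
    by (intro zero_count_cong dF) auto
  also have "\<dots> = zero_count (\<lambda>z. deriv f (\<psi> z) * deriv \<psi> z) (ball 0 1)"
    using r by (intro zero_count_cmult) auto
  also have "\<dots> = zero_count (\<lambda>z. deriv f (\<psi> z)) (ball 0 1)"
  proof (rule zero_count_mult_nonvanishing)
    show "(\<lambda>z. deriv f (\<psi> z)) holomorphic_on ball 0 1"
      using holomorphic_on_compose_gen[OF hol(2) df im] by (simp add: o_def)
    show "\<exists>z\<in>ball 0 1. deriv f (\<psi> z) \<noteq> 0"
      using exd \<phi> by metis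
    show "deriv \<psi> holomorphic_on ball 0 1" using hol(2) by (intro holomorphic_deriv) auto
    show "deriv \<psi> z \<noteq> 0" if "z \<in> ball 0 1" for z
      using bij that by (intro holomorphic_injective_imp_regular[OF hol(2)]) (auto simp: bij_betw_def)
  qed auto
  also have "\<dots> = zero_count (deriv f) V"
    by (intro zero_count_compose_biholomorphic V hol bij exd df) auto
  finally show "zero_count (deriv f) V + 1 = zero_count (\<lambda>z. f z - c) V"
    using counts(2) F0 by simp
qed

text \<open>
  A map that takes every value of a disk exactly once, with multiplicity, has a holomorphic inverse there.
\<close>

lemma inverse_on_disc_of_degree_one:
  assumes V: "open V" "connected V"
    and f: "f holomorphic_on V" "\<not> f constant_on V" and fV: "f ` V \<subseteq> ball c r"
    and one: "\<And>w. w \<in> ball c r \<Longrightarrow> zero_count (\<lambda>z. f z - w) V = 1"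
  obtains h where "h holomorphic_on ball c r" "h ` ball c r \<subseteq> V" "\<And>w. w \<in> ball c r \<Longrightarrow> f (h w) = w"
proof -
  have ex: "\<exists>z\<in>V. f z - w \<noteq> 0" for w
    using f(2) by (auto simp: constant_on_def)
  have pos: "0 < zorder (\<lambda>z. f z - w) z" if "z \<in> V" "f z = w" for w z
    using that f V ex by (intro zorder_pos_at_zero[of _ V]) (auto intro!: holomorphic_intros)
  have inj: "inj_on f V"
  proof (rule inj_onI, rule ccontr)
    fix x y assume xy: "x \<in> V" "y \<in> V" "f x = f y" "x \<noteq> y"
    define g where "g = (\<lambda>z. f z - f x)"
    have g1: "(\<Sum>z\<in>{z\<in>V. g z = 0}. zorder g z) = 1"
      using one[of "f x"] fV xy(1) by (auto simp: zero_count_def g_def)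
    \<comment> \<open>A sum over an infinite set would be \<open>0\<close>.\<close>
    then have fin: "finite {z\<in>V. g z = 0}"
      by (metis sum.infinite zero_neq_one)
    have gpos: "0 < zorder g z" if "z \<in> V" "g z = 0" for z
      using pos[of z "f x"] that by (simp add: g_def)
    have "(\<Sum>z\<in>{x, y}. zorder g z) \<le> (\<Sum>z\<in>{z\<in>V. g z = 0}. zorder g z)"
      using xy gpos by (intro sum_mono2[OF fin]) (auto simp: g_def less_imp_le)
    moreover have "0 < zorder g x" "0 < zorder g y" using gpos xy by (auto simp: g_def)
    ultimately show False using g1 xy(4) by simp
  qed
  have onto: "ball c r \<subseteq> f ` V"
  proof
    fix w assume "w \<in> ball c r"
    then have "(\<Sum>z\<in>{z\<in>V. f z - w = 0}. zorder (\<lambda>z. f z - w) z) \<noteq> 0"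
      using one by (simp add: zero_count_def)
    then have "{z\<in>V. f z - w = 0} \<noteq> {}" by (metis sum.empty)
    then show "w \<in> f ` V" by force
  qed
  obtain h where h: "h holomorphic_on f ` V" "\<And>z. z \<in> V \<Longrightarrow> h (f z) = z"
    using holomorphic_has_inverse[OF f(1) V(1) inj] by metis
  show ?thesis
  proof
    show "h holomorphic_on ball c r" using h(1) onto by (rule holomorphic_on_subset)
    show "h ` ball c r \<subseteq> V" using onto h(2) by force
    show "f (h w) = w" if "w \<in> ball c r" for w using onto that h(2) by force
  qed
qed

section \<open>Components of the preimage of a disk\<close>

text \<open>
  Simple connectivity comes from the maximum principle: if \<open>K\<close> is a compact connected subset of the
  component, then \<open>\<bar>f - c\<bar> < r\<close> holds on \<open>K\<close> and therefore on the bounded components of its complement,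
  which thus belong to the same component of the preimage.
\<close>

lemma component_of_disc_preimage:
  assumes D: "convex D" "bounded D" "open D" and f: "f holomorphic_on D"
    and V: "V \<in> components {z\<in>D. norm (f z - c) < r}"
  shows "open V" "connected V" "simply_connected V" "V \<noteq> {}" "V \<noteq> UNIV" "V \<subseteq> D"
proof -
  let ?U = "{z\<in>D. norm (f z - c) < r}"
  have cont: "continuous_on D (\<lambda>z. norm (f z - c))"
    using f by (intro continuous_intros holomorphic_on_imp_continuous_on)
  have "open (D \<inter> (\<lambda>z. norm (f z - c)) -` {..<r})"
    using cont D(3) by (intro continuous_open_preimage) auto
  moreover have "D \<inter> (\<lambda>z. norm (f z - c)) -` {..<r} = ?U" by auto
  ultimately have openU: "open ?U" by simp
  show op: "open V" using openU V by (rule open_components)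
  show con: "connected V" using V by (rule in_components_connected)
  show "V \<noteq> {}" using V by (rule in_components_nonempty)
  have VU: "V \<subseteq> ?U" using V by (rule in_components_subset)
  then show VD: "V \<subseteq> D" by auto
  show "V \<noteq> UNIV"
    using D(2) VD bounded_subset not_bounded_UNIV by blast
  have inside: "inside K \<subseteq> V" if K: "compact K" "connected K" "K \<noteq> {}" "K \<subseteq> V" for K
  proof -
    have KD: "K \<subseteq> D" using K(4) VD by auto
    have insD: "inside K \<subseteq> D"
      using inside_mono[OF KD] inside_convex[OF D(1)] by auto
    have cl: "closure (inside K) \<subseteq> D"
      using closure_inside_subset[OF compact_imp_closed[OF K(1)]] KD insD by auto
    obtain x where x: "x \<in> K" "\<And>y. y \<in> K \<Longrightarrow> norm (f y - c) \<le> norm (f x - c)"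
      using continuous_attains_sup[OF K(1,3) continuous_on_subset[OF cont KD]] by auto
    have "norm (f z - c) \<le> norm (f x - c)" if "z \<in> inside K" for z
    proof (rule maximum_modulus_frontier[where S = "inside K" and f = "\<lambda>z. f z - c"])
      show "(\<lambda>z. f z - c) holomorphic_on interior (inside K)"
        using f insD interior_subset[of "inside K"]
        by (auto intro!: holomorphic_intros intro: holomorphic_on_subset)
      show "continuous_on (closure (inside K)) (\<lambda>z. f z - c)"
        using f cl by (intro continuous_intros holomorphic_on_imp_continuous_on)
          (auto intro: holomorphic_on_subset)
      show "bounded (inside K)" using K(1) by (intro bounded_inside compact_imp_bounded)
      show "norm (f z - c) \<le> norm (f x - c)" if "z \<in> frontier (inside K)" for z
        using that x(2) frontier_inside_subset[OF compact_imp_closed[OF K(1)]] by blast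
    qed fact
    moreover have "norm (f x - c) < r" using x(1) K(4) VU by auto
    ultimately have "K \<union> inside K \<subseteq> ?U" using insD K(4) VU by force
    moreover have "connected (K \<union> inside K)"
      using K compact_imp_closed by (intro connected_with_inside)
    ultimately have "K \<union> inside K \<subseteq> V"
      using K(3,4) by (intro components_maximal[OF V]) auto
    then show ?thesis by auto
  qed
  show "simply_connected V"
    unfolding simply_connected_eq_winding_number_zero[OF op]
  proof (intro conjI con allI impI)
    fix g z
    assume g: "path g \<and> path_image g \<subseteq> V \<and> pathfinish g = pathstart g \<and> z \<notin> V"
    then have "inside (path_image g) \<subseteq> V"
      by (intro inside) (auto simp: compact_path_image connected_path_image)
    then have "z \<in> outside (path_image g)"
      using g inside_Un_outside[of "path_image g"] by blast
    then show "winding_number g z = 0"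
      using g by (intro winding_number_zero_in_outside) auto
  qed
qed

text \<open>
  Zeros are counted component by component. The family \<open>C\<close> may be any finite set of components that
  includes all those which contain a zero, so that finiteness of the set of all components is not
  required.
\<close>

lemma zero_count_components:
  assumes "finite {z\<in>U. f z = 0}" "finite C" "\<And>z. z \<in> U \<Longrightarrow> f z = 0 \<Longrightarrow> connected_component_set U z \<in> C"
    and "C \<subseteq> components U"
  shows "zero_count f U = (\<Sum>V\<in>C. zero_count f V)"
proof -
  have "zero_count f U
      = (\<Sum>V\<in>C. \<Sum>z\<in>{z. z \<in> {z\<in>U. f z = 0} \<and> connected_component_set U z = V}. zorder f z)"
    unfolding zero_count_def using assms(1-3) by (intro sum.group[symmetric]) auto
  also have "\<dots> = (\<Sum>V\<in>C. zero_count f V)"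
    unfolding zero_count_def
  proof (intro sum.cong refl)
    fix V assume "V \<in> C"
    then obtain x where x: "x \<in> U" "V = connected_component_set U x"
      using assms(4) by (metis components_iff subsetD)
    have mem: "z \<in> V \<longleftrightarrow> z \<in> U \<and> connected_component_set U z = V" for z
      unfolding x(2) using connected_component_eq[of z U x] connected_component_subset[of U x]
        connected_component_refl_eq[of U z] by blast
    show "{z. z \<in> {z\<in>U. f z = 0} \<and> connected_component_set U z = V} = {z\<in>V. f z = 0}"
      using mem by auto
  qed
  finally show ?thesis .
qed

section \<open>Inverse branches of Blaschke products on disks\<close>

context blaschke
begin

lemma deriv_nonzero:
  assumes "J \<noteq> {}" "norm z = 1"
  shows "deriv (blaschke_prod c J a) z \<noteq> 0"
  using log_derivative[OF assms(2,1)] norm_eq[OF assms(2)] by fastforce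

text \<open>
  The restriction of a Blaschke product to a component of the preimage of a disk \<open>ball w r\<close> is a proper
  map to that disk. The disk may touch the unit circle.
\<close>

lemma compact_preimage_component:
  assumes sub: "ball w r \<subseteq> ball 0 1"
    and V: "V \<in> components {z\<in>ball 0 1. norm (blaschke_prod c J a z - w) < r}" and \<rho>: "\<rho> < r"
  shows "compact {z\<in>V. norm (blaschke_prod c J a z - w) \<le> \<rho>}"
proof -
  let ?G = "blaschke_prod c J a"
  let ?U = "{z\<in>ball 0 1. norm (?G z - w) < r}"
  let ?K = "{z\<in>cball 0 1. norm (?G z - w) \<le> \<rho>}"
  have "continuous_on (cball 0 1) (\<lambda>z. ?G z - w)"
    by (intro continuous_intros holomorphic_on_imp_continuous_on analytic_imp_holomorphic analytic)
  then have K: "compact ?K" by (rule compact_sublevel_cball)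
  \<comment> \<open>Points of the unit circle are excluded from \<open>K\<close> because their images are unimodular, while \<open>K\<close> is mapped
    into \<open>ball w r \<subseteq> ball 0 1\<close>.\<close>
  have KU: "?K \<subseteq> ?U"
  proof
    fix z assume z: "z \<in> ?K"
    then have "?G z \<in> ball w r" using \<rho> by (auto simp: dist_norm norm_minus_commute)
    then have "norm (?G z) < 1" using sub by auto
    then have "norm z \<noteq> 1" using norm_eq[of z] by auto
    then show "z \<in> ?U" using z \<rho> by auto
  qed
  obtain T where T: "closed T" "V = ?U \<inter> T"
    using closedin_component[OF V] by (auto simp: closedin_closed)
  have "{z\<in>V. norm (?G z - w) \<le> \<rho>} = ?K \<inter> T"
    using KU T(2) by auto
  then show ?thesis using K T(1) by (simp add: compact_Int_closed)
qed

text \<open>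
  If no inverse branch exists on the disk, then every component of its preimage has degree \<open>d \<ge> 2\<close> and
  hence contains \<open>d - 1 \<ge> d / 2\<close> critical points; summation over the components gives the bound.
\<close>

lemma disc_branch_or_critical:
  assumes J: "J \<noteq> {}" and r: "0 < r" and sub: "ball w r \<subseteq> ball 0 1"
    and none: "\<nexists>h. h holomorphic_on ball w r \<and> h ` ball w r \<subseteq> ball 0 1 \<and>
      (\<forall>v\<in>ball w r. blaschke_prod c J a (h v) = v)"
  shows "zero_count (blaschke_prod c J a) (ball 0 1)
    \<le> 2 * zero_count (deriv (blaschke_prod c J a)) {z\<in>ball 0 1. norm (blaschke_prod c J a z - w) < r}"
proof -
  let ?G = "blaschke_prod c J a"
  define U where "U = {z\<in>ball 0 1. norm (?G z - w) < r}"
  have hol: "?G holomorphic_on ball 0 1"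
    by (rule analytic_imp_holomorphic, rule analytic_on_subset[OF analytic]) auto
  have dan: "deriv ?G analytic_on cball 0 1" using analytic by (rule analytic_deriv)
  have w1: "norm w < 1" using sub r by (metis centre_in_ball dist_0_norm mem_ball subsetD)
  have wan: "(\<lambda>z. ?G z - w) analytic_on cball 0 1" using analytic by (intro analytic_intros)
  have wnz: "?G z - w \<noteq> 0" if "norm z = 1" for z using norm_eq[OF that] w1 by auto
  note dz = analytic_on_cball_zeros[OF dan deriv_nonzero[OF J]]
  have fin1: "finite {z\<in>U. deriv ?G z = 0}"
    by (rule finite_subset[OF _ dz(1)]) (auto simp: U_def)
  have "finite {z\<in>ball 0 1. ?G z - w = 0}"
    using wan wnz by (rule analytic_on_cball_zeros(1))
  then have fin2: "finite {z\<in>U. ?G z - w = 0}"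
    by (rule rev_finite_subset) (auto simp: U_def)
  note fin = fin1 fin2
  define C where "C = connected_component_set U ` ({z\<in>U. deriv ?G z = 0} \<union> {z\<in>U. ?G z - w = 0})"
  have C: "finite C" "C \<subseteq> components U"
    using fin by (auto simp: C_def components_def)
  have split: "zero_count f U = (\<Sum>V\<in>C. zero_count f V)"
    if "f = deriv ?G \<or> f = (\<lambda>z. ?G z - w)" for f
    using that fin C by (intro zero_count_components) (auto simp: C_def)
  have "zero_count (\<lambda>z. ?G z - w) V \<le> 2 * zero_count (deriv ?G) V" if "V \<in> C" for V
  proof -
    have V: "V \<in> components {z\<in>ball 0 1. norm (?G z - w) < r}"
      using that C(2) by (auto simp: U_def)
    note top = component_of_disc_preimage[OF convex_ball bounded_ball open_ball hol V]
    have VU: "\<And>z. z \<in> V \<Longrightarrow> norm (?G z - w) < r" using in_components_subset[OF V] by auto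
    have Vhol: "?G holomorphic_on V" using hol top(6) by (rule holomorphic_on_subset)
    note counts = proper_map_to_disc_counts[OF top(1-5) Vhol r VU compact_preimage_component[OF sub V]]
    have "zero_count (\<lambda>z. ?G z - w) V \<noteq> 1"
    proof
      assume one: "zero_count (\<lambda>z. ?G z - w) V = 1"
      have "zero_count (\<lambda>z. ?G z - v) V = 1" if "v \<in> ball w r" for v
        using counts(1)[of v] that one by (simp add: dist_norm norm_minus_commute)
      moreover have "?G ` V \<subseteq> ball w r" using VU by (auto simp: dist_norm norm_minus_commute)
      ultimately obtain h where "h holomorphic_on ball w r" "h ` ball w r \<subseteq> V"
        "\<And>v. v \<in> ball w r \<Longrightarrow> ?G (h v) = v"
        using inverse_on_disc_of_degree_one[OF top(1,2) Vhol counts(3)] by metis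
      then show False using none top(6) by blast
    qed
    moreover have "0 \<le> zero_count (deriv ?G) V"
      unfolding zero_count_def using dz(3) top(6) by (intro sum_nonneg) (auto simp: subset_iff less_imp_le)
    ultimately show ?thesis using counts(2) by simp
  qed
  then have "zero_count (\<lambda>z. ?G z - w) U \<le> 2 * zero_count (deriv ?G) U"
    using split by (simp add: sum_distrib_left sum_mono)
  moreover have "{z\<in>U. ?G z - w = 0} = {z\<in>ball 0 1. ?G z - w = 0}"
    using r by (auto simp: U_def)
  then have "zero_count (\<lambda>z. ?G z - w) U = zero_count ?G (ball 0 1)"
    using zero_count_shift[OF w1] by (simp add: zero_count_def)
  ultimately show ?thesis by (simp add: U_def)
qed

text \<open>
  Two disjoint disks without inverse branch would require at least \<open>n / 2 + n / 2\<close> critical points, where \<open>n\<close>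
  is the degree, while there are only \<open>n - 1\<close>.
\<close>

lemma disc_branch_exists:
  assumes J: "J \<noteq> {}" and r: "0 < r1" "0 < r2"
    and sub: "ball w1 r1 \<subseteq> ball 0 1" "ball w2 r2 \<subseteq> ball 0 1" and disj: "ball w1 r1 \<inter> ball w2 r2 = {}"
  shows "\<exists>h. (h holomorphic_on ball w1 r1 \<and> h ` ball w1 r1 \<subseteq> ball 0 1 \<and>
        (\<forall>v\<in>ball w1 r1. blaschke_prod c J a (h v) = v)) \<or>
      (h holomorphic_on ball w2 r2 \<and> h ` ball w2 r2 \<subseteq> ball 0 1 \<and>
        (\<forall>v\<in>ball w2 r2. blaschke_prod c J a (h v) = v))"
proof (rule ccontr)
  assume contra: "\<not> ?thesis"
  let ?G = "blaschke_prod c J a"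
  define U where "U = (\<lambda>w r. {z\<in>ball 0 1. norm (?G z - w) < r})"
  let ?Z = "\<lambda>S. {z\<in>S. deriv ?G z = 0}"
  have dan: "deriv ?G analytic_on cball 0 1" using analytic by (rule analytic_deriv)
  note dz = analytic_on_cball_zeros[OF dan deriv_nonzero[OF J]]
  have 1: "zero_count ?G (ball 0 1) \<le> 2 * zero_count (deriv ?G) (U w1 r1)"
    using disc_branch_or_critical[OF J r(1) sub(1)] contra by (auto simp: U_def)
  have 2: "zero_count ?G (ball 0 1) \<le> 2 * zero_count (deriv ?G) (U w2 r2)"
    using disc_branch_or_critical[OF J r(2) sub(2)] contra by (auto simp: U_def)
  have fin: "finite (?Z (U w r))" for w r
    by (rule finite_subset[OF _ dz(1)]) (auto simp: U_def)
  have dis: "?Z (U w1 r1) \<inter> ?Z (U w2 r2) = {}"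
    using disj by (auto simp: U_def disjoint_iff dist_norm norm_minus_commute)
  have "zero_count (deriv ?G) (U w1 r1) + zero_count (deriv ?G) (U w2 r2)
      = (\<Sum>z\<in>?Z (U w1 r1) \<union> ?Z (U w2 r2). zorder (deriv ?G) z)"
    unfolding zero_count_def using fin dis by (intro sum.union_disjoint[symmetric])
  also have "\<dots> \<le> zero_count (deriv ?G) (ball 0 1)"
    unfolding zero_count_def using dz(3)
    by (intro sum_mono2 dz(1)) (auto simp: U_def less_imp_le)
  finally show False using 1 2 critical_count[OF J] by linarith
qed

end

theorem corollary1:
  fixes B :: "complex \<Rightarrow> complex"
  assumes "finite_blaschke_product B"
  shows "\<exists>w\<^sub>0 :: complex. surface_contains (surface_of B) (surface_of_domain (ball w\<^sub>0 (1/2)))"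
proof -
  obtain n :: nat and a :: "nat \<Rightarrow> complex" where n: "n \<ge> 1"
    and a: "\<And>j. j \<in> {1..n} \<Longrightarrow> norm (a j) < 1"
    and B: "\<And>z. z \<in> ball 0 1 \<Longrightarrow> B z = (\<Prod>j=1..n. (z - a j) / (1 - cnj (a j) * z))"
    using assms unfolding finite_blaschke_product_def by blast
  interpret blaschke 1 "{1..n}" a
    by standard (use a in auto)
  have eq: "B z = blaschke_prod 1 {1..n} a z" if "z \<in> ball 0 1" for z
    using B[OF that] by (simp add: blaschke_prod_def blaschke_factor_def)
  have sub: "ball w (1/2) \<subseteq> ball 0 1" if "norm w \<le> 1/2" for w :: complex
    using that by (simp add: ball_subset_ball_iff)
  \<comment> \<open>Two disjoint disks of radius \<open>1/2\<close> that fit into the unit disk.\<close>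
  have disj: "ball (1/2 :: complex) (1/2) \<inter> ball (-1/2) (1/2) = {}"
    by (intro disjoint_ballI) (simp add: dist_norm)
  obtain w h where h: "h holomorphic_on ball w (1/2)" "h ` ball w (1/2) \<subseteq> ball 0 1"
    "\<And>v. v \<in> ball w (1/2) \<Longrightarrow> blaschke_prod 1 {1..n} a (h v) = v"
    using disc_branch_exists[OF _ _ _ sub sub disj] n by force
  have inv: "B (h v) = v" if "v \<in> ball w (1/2)" for v
  proof -
    have "h v \<in> ball 0 1" using h(2) that by blast
    then show ?thesis using eq h(3)[OF that] by simp
  qed
  then have "inj_on h (ball w (1/2))" by (metis inj_onI)
  then have "surface_contains (surface_of B) (surface_of_domain (ball w (1/2)))"
    using h inv unfolding surface_contains_def surface_of_def surface_of_domain_def by auto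
  then show ?thesis by blast
qed

end
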